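(* Let $\mathcal L(\lambda)=\begin{bmatrix}M(\lambda)&K_2(\lambda)^T\\ K_1(\lambda)&0\end{bmatrix}$ be a square and regular strong block minimal bases degree-$\ell$ matrix polynomial, let $N_1(\lambda)$ and $N_2(\lambda)$ be minimal bases dual to $K_1(\lambda)$ and $K_2(\lambda)$, respectively, and let $Q(\lambda):=N_2(\lambda)M(\lambda)N_1(\lambda)^T$. For $i=1,2$ let $$U_i(\lambda)=\begin{bmatrix}K_i(\lambda)\\ \widehat K_i(\lambda)\end{bmatrix}\quad\text{be unimodular with}\quad U_i(\lambda)^{-1}=\begin{bmatrix}\widehat N_i(\lambda)^T&N_i(\lambda)^T\end{bmatrix}.$$ Let $\lambda_0$ be a finite eigenvalue of $\mathcal L(\lambda)$, and let $z$ and $w^T$ be, respectively, right and left eigenvectors of $\mathcal L(\lambda)$ associated with $\lambda_0$. Then: (a) The vector $x:=\begin{bmatrix}\widehat K_1(\lambda_0)&0\end{bmatrix}z$ is a right eigenvector of $Q(\lambda)$ for the eigenvalue $\lambda_0$. (b) The vector $y^T:=w^T\begin{bmatrix}\widehat K_2(\lambda_0)^T\\ 0\end{bmatrix}$ is a left eigenvector of $Q(\lambda)$ for the eigenvalue $\lambda_0$.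
   Context: $\mathbb F$ is an arbitrary field with algebraic closure $\overline{\mathbb F}$; all matrix polynomials have coefficients in $\mathbb F$. A matrix polynomial has grade $g$ if it can be written $\sum_{i=0}^gP_i\lambda^i$ (coefficients possibly zero). A square matrix polynomial is regular if its determinant is not the zero polynomial, and unimodular if its determinant is a nonzero constant. A finite eigenvalue of a regular $P(\lambda)$ is a $\lambda_0\in\overline{\mathbb F}$ with $\det P(\lambda_0)=0$; right (left) eigenvectors for $\lambda_0$ are nonzero vectors $x$ (row vectors $y^T$) over $\overline{\mathbb F}$ with $P(\lambda_0)x=0$ ($y^TP(\lambda_0)=0$). A minimal basis of a subspace of $\mathbb F(\lambda)^q$ is a basis of vector polynomials whose sum of degrees is least among all bases of vector polynomials. A $p\times q$ matrix polynomial ($p<q$) is called a minimal basis if its rows form a minimal basis of the rational subspace they span. Row degrees are the degrees of the rows. $K(\lambda)\in\mathbb F[\lambda]^{p_1\times q}$ and $N(\lambda)\in\mathbb F[\lambda]^{p_2\times q}$ are dual minimal bases (each is a minimal basis dual to the other) if $p_1+p_2=q$, $K(\lambda)N(\lambda)^T=0$, and both are minimal bases. Strong block minimal bases degree-$\ell$ matrix polynomial ($\ell>0$): $\mathcal L(\lambda)$ as displayed with $M(\lambda)$ of size $(m+m_2)\times(n+m_1)$ and grade $\ell$, $K_1(\lambda)\in\mathbb F[\lambda]^{m_1\times(n+m_1)}$ and $K_2(\lambda)\in\mathbb F[\lambda]^{m_2\times(m+m_2)}$ minimal bases with all row degrees equal to $\ell$, such that the row degrees of a minimal basis dual to $K_1(\lambda)$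 are all equal, and the row degrees of a minimal basis dual to $K_2(\lambda)$ are all equal. $Q(\lambda)$ is $m\times n$; $\mathcal L$ square means $m=n$. Degenerate cases where exactly one of $K_1,K_2$ is absent ($m_1=0$ or $m_2=0$) are allowed; then for the absent index $N_i=\widehat K_i=I$ and $\widehat N_i$ is empty. For a pair of dual minimal bases $(K_i,N_i)$, unimodular matrices $U_i$ as in the claim always exist. *)

theory Defs
  imports
    "HOL-Algebra.Algebraic_Closure_Type"
    "Jordan_Normal_Form.VS_Connect"
begin

text \<open>
  Matrix polynomials over a field \<open>'a\<close> are matrices of type \<open>'a poly mat\<close>, rational vectors are
  vectors over \<open>'a poly fract\<close>, and the algebraic closure is the type \<open>'a alg_closure\<close> with
  embedding \<^const>\<open>to_ac\<close>. Minimal bases are stored as the rows of a matrix.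
\<close>

definition append_cols :: "'a :: zero mat \<Rightarrow> 'a mat \<Rightarrow> 'a mat" (infixr \<open>@\<^sub>c\<close> 65) where
  "A @\<^sub>c B = four_block_mat A B (0\<^sub>m 0 (dim_col A)) (0\<^sub>m 0 (dim_col B))"

text \<open>The product of a row vector (stored as a plain vector) with a matrix.\<close>

definition row_vec_mult_mat :: "'a :: semiring_0 vec \<Rightarrow> 'a mat \<Rightarrow> 'a vec" (infixl \<open>\<^sub>v*\<close> 70) where
  "y \<^sub>v* A = vec (dim_col A) (\<lambda>j. y \<bullet> col A j)"


definition has_grade :: "nat \<Rightarrow> 'a :: field poly mat \<Rightarrow> bool" where
  "has_grade g P \<longleftrightarrow>
     (\<exists>C :: nat \<Rightarrow> 'a mat.
        (\<forall>k\<le>g. C k \<in> carrier_mat (dim_row P) (dim_col P)) \<and>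
        P = mat (dim_row P) (dim_col P) (\<lambda>(i, j). \<Sum>k\<le>g. monom (C k $$ (i, j)) k))"

definition regular_matpoly :: "'a :: field poly mat \<Rightarrow> bool" where
  "regular_matpoly P \<longleftrightarrow> square_mat P \<and> det P \<noteq> 0"

definition unimodular_matpoly :: "'a :: field poly mat \<Rightarrow> bool" where
  "unimodular_matpoly P \<longleftrightarrow> square_mat P \<and> (\<exists>c. c \<noteq> 0 \<and> det P = [:c:])"

definition eval_mat :: "'a :: field poly mat \<Rightarrow> 'a alg_closure \<Rightarrow> 'a alg_closure mat" where
  "eval_mat P x = map_mat (\<lambda>p. poly (map_poly to_ac p) x) P"

definition finite_eigenvalue :: "'a :: field poly mat \<Rightarrow> 'a alg_closure \<Rightarrow> bool" where
  "finite_eigenvalue P x0 \<longleftrightarrow> regular_matpoly P \<and> det (eval_mat P x0) = 0"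

definition right_eigenvector ::
    "'a :: field poly mat \<Rightarrow> 'a alg_closure \<Rightarrow> 'a alg_closure vec \<Rightarrow> bool" where
  "right_eigenvector P x0 x \<longleftrightarrow>
     finite_eigenvalue P x0 \<and> x \<in> carrier_vec (dim_col P) \<and> x \<noteq> 0\<^sub>v (dim_col P) \<and>
     eval_mat P x0 *\<^sub>v x = 0\<^sub>v (dim_row P)"

definition left_eigenvector ::
    "'a :: field poly mat \<Rightarrow> 'a alg_closure \<Rightarrow> 'a alg_closure vec \<Rightarrow> bool" where
  "left_eigenvector P x0 y \<longleftrightarrow>
     finite_eigenvalue P x0 \<and> y \<in> carrier_vec (dim_row P) \<and> y \<noteq> 0\<^sub>v (dim_row P) \<and>
     y \<^sub>v* eval_mat P x0 = 0\<^sub>v (dim_col P)"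


text \<open>
  The degree of a vector polynomial is the largest degree of its entries; inserting \<open>0\<close> only
  makes it meaningful for the vector of dimension \<open>0\<close>.
\<close>

definition vec_degree :: "'a :: field poly vec \<Rightarrow> nat" where
  "vec_degree v = Max (insert 0 ((\<lambda>i. degree (v $ i)) ` {..<dim_vec v}))"

definition row_degree :: "'a :: field poly mat \<Rightarrow> nat \<Rightarrow> nat" where
  "row_degree P i = vec_degree (row P i)"

abbreviation rat_vec :: "'a :: field poly vec \<Rightarrow> 'a poly fract vec" where
  "rat_vec \<equiv> map_vec to_fract"

text \<open>
  \<open>B\<close> consists of vector polynomials and is a basis, over the rational functions, of the
  subspace \<open>V\<close>.
\<close>

definition polynomial_basis ::
    "nat \<Rightarrow> 'a :: field poly fract vec set \<Rightarrow> 'a poly vec set \<Rightarrow> bool" where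
  "polynomial_basis q V B \<longleftrightarrow>
     finite B \<and> B \<subseteq> carrier_vec q \<and>
     \<not> LinearCombinations.module.lin_dep class_ring (module_vec TYPE('a poly fract) q) (rat_vec ` B) \<and>
     LinearCombinations.module.span class_ring (module_vec TYPE('a poly fract) q) (rat_vec ` B) = V"

definition minimal_polynomial_basis ::
    "nat \<Rightarrow> 'a :: field poly fract vec set \<Rightarrow> 'a poly vec set \<Rightarrow> bool" where
  "minimal_polynomial_basis q V B \<longleftrightarrow>
     polynomial_basis q V B \<and>
     (\<forall>B'. polynomial_basis q V B' \<longrightarrow> (\<Sum>v\<in>B. vec_degree v) \<le> (\<Sum>v\<in>B'. vec_degree v))"

definition rational_row_space :: "'a :: field poly mat \<Rightarrow> 'a poly fract vec set" where
  "rational_row_space K = vec_space.row_space (dim_col K) (map_mat to_fract K)"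

text \<open>Distinctness is needed because the rows form a basis as a family, not only as a set.\<close>

definition minimal_basis :: "'a :: field poly mat \<Rightarrow> bool" where
  "minimal_basis K \<longleftrightarrow>
     dim_row K < dim_col K \<and> distinct (rows K) \<and>
     minimal_polynomial_basis (dim_col K) (rational_row_space K) (set (rows K))"

definition dual_minimal_bases :: "'a :: field poly mat \<Rightarrow> 'a poly mat \<Rightarrow> bool" where
  "dual_minimal_bases K N \<longleftrightarrow>
     dim_col K = dim_col N \<and> dim_row K + dim_row N = dim_col K \<and>
     K * N\<^sup>T = 0\<^sub>m (dim_row K) (dim_row N) \<and> minimal_basis K \<and> minimal_basis N"


text \<open>
  The condition on a block \<open>K\<close> that is present. The row degrees of a minimal basis of a given
  subspace are unique up to order, so it does not matter which dual minimal basis is inspected.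
\<close>

definition strong_minimal_basis :: "nat \<Rightarrow> 'a :: field poly mat \<Rightarrow> bool" where
  "strong_minimal_basis l K \<longleftrightarrow>
     minimal_basis K \<and> (\<forall>i<dim_row K. row_degree K i = l) \<and>
     (\<exists>N d. dual_minimal_bases K N \<and> (\<forall>i<dim_row N. row_degree N i = d))"

text \<open>
  The blocks \<open>M\<close>, \<open>K1\<close>, \<open>K2\<close> of a strong block minimal bases degree-\<open>l\<close> matrix polynomial. An absent
  block is a matrix with no rows; at most one of \<open>K1\<close>, \<open>K2\<close> may be absent.
\<close>

definition strong_block_minimal_bases ::
    "nat \<Rightarrow> nat \<Rightarrow> nat \<Rightarrow> nat \<Rightarrow> nat \<Rightarrow> 'a :: field poly mat \<Rightarrow> 'a poly mat \<Rightarrow> 'a poly mat \<Rightarrow> bool" where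
  "strong_block_minimal_bases l m n m1 m2 M K1 K2 \<longleftrightarrow>
     0 < l \<and> 0 < m \<and> 0 < n \<and> (0 < m1 \<or> 0 < m2) \<and>
     M \<in> carrier_mat (m + m2) (n + m1) \<and> has_grade l M \<and>
     K1 \<in> carrier_mat m1 (n + m1) \<and> (0 < m1 \<longrightarrow> strong_minimal_basis l K1) \<and>
     K2 \<in> carrier_mat m2 (m + m2) \<and> (0 < m2 \<longrightarrow> strong_minimal_basis l K2)"

definition block_minimal_bases_mat ::
    "'a :: field poly mat \<Rightarrow> 'a poly mat \<Rightarrow> 'a poly mat \<Rightarrow> 'a poly mat" where
  "block_minimal_bases_mat M K1 K2 = four_block_mat M K2\<^sup>T K1 (0\<^sub>m (dim_row K1) (dim_row K2))"

text \<open>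
  \<open>N\<close> is a minimal basis dual to \<open>K\<close>, and \<open>[K; Kh]\<close> is unimodular with inverse
  \<open>[Nh\<^sup>T  N\<^sup>T]\<close>. If \<open>K\<close> is absent (it has no rows), then by convention \<open>N = Kh = I\<close> and
  \<open>Nh\<close> is empty.
\<close>

definition unimodular_completion ::
    "'a :: field poly mat \<Rightarrow> 'a poly mat \<Rightarrow> 'a poly mat \<Rightarrow> 'a poly mat \<Rightarrow> bool" where
  "unimodular_completion K N Kh Nh \<longleftrightarrow>
     (if dim_row K = 0 then N = 1\<^sub>m (dim_col K) \<and> Kh = 1\<^sub>m (dim_col K) else dual_minimal_bases K N) \<and>
     Kh \<in> carrier_mat (dim_col K - dim_row K) (dim_col K) \<and>
     Nh \<in> carrier_mat (dim_row K) (dim_col K) \<and>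
     unimodular_matpoly (K @\<^sub>r Kh) \<and>
     inverts_mat (K @\<^sub>r Kh) (Nh\<^sup>T @\<^sub>c N\<^sup>T) \<and> inverts_mat (Nh\<^sup>T @\<^sub>c N\<^sup>T) (K @\<^sub>r Kh)"

end

theory Submission
  imports Defs "Jordan_Normal_Form.Char_Poly"
begin

text \<open>
  A vector \<open>z = [z1; z2]\<close> lies in the kernel of the block matrix \<open>L\<close> iff \<open>M z1 + K2\<^sup>T z2 = 0\<close> and
  \<open>K1 z1 = 0\<close>. The completion of \<open>K1\<close> splits every vector as \<open>z1 = Nh1\<^sup>T (K1 z1) + N1\<^sup>T (Kh1 z1)\<close>,
  so the second equation says \<open>z1 = N1\<^sup>T x\<close> with \<open>x = Kh1 z1\<close>. Multiplying the first equation
  by \<open>N2\<close> removes \<open>z2\<close>, because \<open>N2 K2\<^sup>T = 0\<close>, and leaves \<open>Q x = N2 M N1\<^sup>T x = 0\<close>. If \<open>x = 0\<close>, then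
  \<open>z1 = 0\<close> and \<open>K2\<^sup>T z2 = 0\<close>; as \<open>K2\<^sup>T\<close> has the left inverse \<open>Nh2\<close>, also \<open>z2 = 0\<close>. Hence \<open>x\<close> is
  nonzero whenever \<open>z\<close> is. This is \<open>block_kernel_imp_Q_kernel\<close>.

  The map \<open>z \<mapsto> x\<close> between the kernels is in fact onto: a vector \<open>v\<close> with \<open>Q v = 0\<close> comes from the
  kernel vector with \<open>z1 = N1\<^sup>T v\<close> and \<open>z2 = - Nh2 M z1\<close> (\<open>Q_kernel_imp_block_kernel\<close>). All this
  is computation with the block identities of the completions, so it is valid over every
  commutative ring and is applied over two of them. Over the algebraic closure, where the identities have been
  evaluated at \<open>\<lambda>\<^sub>0\<close>, the first direction gives the eigenvector. Over the polynomial ring, the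
  second direction gives regularity: if \<open>det Q\<close> were the zero polynomial, then \<open>Q\<close>, and with it
  \<open>L\<close>, would have a nonzero polynomial vector in its kernel, contradicting \<open>det L \<noteq> 0\<close>.

  Left eigenvectors are the right eigenvectors of the transpose, and transposing \<open>L\<close> amounts to
  transposing \<open>M\<close> and exchanging the roles of \<open>K1\<close> and \<open>K2\<close>. So part (b) is part (a) for the
  transposed data.
\<close>

section \<open>Completed pairs of dual bases\<close>

text \<open>
  The identities between blocks that \<open>U U\<^sup>-\<^sup>1 = 1\<close> and \<open>U\<^sup>-\<^sup>1 U = 1\<close> express for \<open>U = [K; Kh]\<close> with
  inverse \<open>[Nh\<^sup>T  N\<^sup>T]\<close>. They are stated over an arbitrary commutative ring because they are needed
  twice: for the polynomial matrices and, by \<open>complementary_bases_hom\<close>, for their values at a point.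
\<close>

definition complementary_bases ::
    "nat \<Rightarrow> nat \<Rightarrow> 'a :: comm_ring_1 mat \<Rightarrow> 'a mat \<Rightarrow> 'a mat \<Rightarrow> 'a mat \<Rightarrow> bool" where
  "complementary_bases r p K N Kh Nh \<longleftrightarrow>
     K \<in> carrier_mat r (p + r) \<and> N \<in> carrier_mat p (p + r) \<and>
     Kh \<in> carrier_mat p (p + r) \<and> Nh \<in> carrier_mat r (p + r) \<and>
     K * Nh\<^sup>T = 1\<^sub>m r \<and> K * N\<^sup>T = 0\<^sub>m r p \<and> Kh * N\<^sup>T = 1\<^sub>m p \<and>
     Nh\<^sup>T * K + N\<^sup>T * Kh = 1\<^sub>m (p + r)"

text \<open>
  These equations give the resolution of a vector along the decompositions
  \<open>Nh\<^sup>T K + N\<^sup>T Kh = 1\<close> and, after transposing, \<open>K\<^sup>T Nh + Kh\<^sup>T N = 1\<close>, together with its coordinates.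
  The kernel computations below use the completions in this form.
\<close>

lemma complementary_bases_vec:
  assumes "complementary_bases r p K N Kh Nh"
  shows "v \<in> carrier_vec (p + r) \<Longrightarrow> Nh\<^sup>T *\<^sub>v (K *\<^sub>v v) + N\<^sup>T *\<^sub>v (Kh *\<^sub>v v) = v"
    and "v \<in> carrier_vec (p + r) \<Longrightarrow> K\<^sup>T *\<^sub>v (Nh *\<^sub>v v) + Kh\<^sup>T *\<^sub>v (N *\<^sub>v v) = v"
    and "v \<in> carrier_vec p \<Longrightarrow> K *\<^sub>v (N\<^sup>T *\<^sub>v v) = 0\<^sub>v r"
    and "v \<in> carrier_vec p \<Longrightarrow> Kh *\<^sub>v (N\<^sup>T *\<^sub>v v) = v"
    and "v \<in> carrier_vec r \<Longrightarrow> N *\<^sub>v (K\<^sup>T *\<^sub>v v) = 0\<^sub>v p"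
    and "v \<in> carrier_vec r \<Longrightarrow> Nh *\<^sub>v (K\<^sup>T *\<^sub>v v) = v"
proof -
  have K: "K \<in> carrier_mat r (p + r)" and N: "N \<in> carrier_mat p (p + r)"
    and Kh: "Kh \<in> carrier_mat p (p + r)" and Nh: "Nh \<in> carrier_mat r (p + r)"
    and KNh: "K * Nh\<^sup>T = 1\<^sub>m r" and KN: "K * N\<^sup>T = 0\<^sub>m r p" and KhN: "Kh * N\<^sup>T = 1\<^sub>m p"
    and sum: "Nh\<^sup>T * K + N\<^sup>T * Kh = 1\<^sub>m (p + r)"
    using assms unfolding complementary_bases_def by auto
  note T = transpose_carrier_mat[THEN iffD2]
  have tr: "(A * B\<^sup>T)\<^sup>T = B * A\<^sup>T" if "A \<in> carrier_mat i k" "B \<in> carrier_mat j k"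
    for A B :: "'a mat" and i j k
    using transpose_mult[OF that(1) T[OF that(2)]] by simp
  have NhK: "Nh * K\<^sup>T = 1\<^sub>m r" using tr[OF K Nh] KNh by simp
  have NK: "N * K\<^sup>T = 0\<^sub>m p r" using tr[OF K N] KN by simp
  have sumT: "K\<^sup>T * Nh + Kh\<^sup>T * N = 1\<^sub>m (p + r)"
    using arg_cong[OF sum, of transpose_mat] K N Kh Nh
    by (simp add: transpose_add[of _ "p + r" "p + r"] transpose_mult[of _ "p + r" r _ "p + r"]
        transpose_mult[of _ "p + r" p _ "p + r"])
  note assoc = assoc_mult_mat_vec[symmetric]
  show "Nh\<^sup>T *\<^sub>v (K *\<^sub>v v) + N\<^sup>T *\<^sub>v (Kh *\<^sub>v v) = v" if v: "v \<in> carrier_vec (p + r)"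
    unfolding assoc[OF T[OF Nh] K v] assoc[OF T[OF N] Kh v]
    using add_mult_distrib_mat_vec[of "Nh\<^sup>T * K" "p + r" "p + r" "N\<^sup>T * Kh" v] sum v K N Kh Nh
    by simp
  show "K\<^sup>T *\<^sub>v (Nh *\<^sub>v v) + Kh\<^sup>T *\<^sub>v (N *\<^sub>v v) = v" if v: "v \<in> carrier_vec (p + r)"
    unfolding assoc[OF T[OF K] Nh v] assoc[OF T[OF Kh] N v]
    using add_mult_distrib_mat_vec[of "K\<^sup>T * Nh" "p + r" "p + r" "Kh\<^sup>T * N" v] sumT v K N Kh Nh
    by simp
  show "K *\<^sub>v (N\<^sup>T *\<^sub>v v) = 0\<^sub>v r" if v: "v \<in> carrier_vec p"
    unfolding assoc[OF K T[OF N] v] KN using v by auto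
  show "Kh *\<^sub>v (N\<^sup>T *\<^sub>v v) = v" if v: "v \<in> carrier_vec p"
    unfolding assoc[OF Kh T[OF N] v] KhN using v by auto
  show "N *\<^sub>v (K\<^sup>T *\<^sub>v v) = 0\<^sub>v p" if v: "v \<in> carrier_vec r"
    unfolding assoc[OF N T[OF K] v] NK using v by auto
  show "Nh *\<^sub>v (K\<^sup>T *\<^sub>v v) = v" if v: "v \<in> carrier_vec r"
    unfolding assoc[OF Nh T[OF K] v] NhK using v by auto
qed

lemma complementary_bases_hom:
  assumes "comm_ring_hom h" and "complementary_bases r p K N Kh Nh"
  shows "complementary_bases r p (map_mat h K) (map_mat h N) (map_mat h Kh) (map_mat h Nh)"
proof -
  interpret comm_ring_hom h by fact
  have K: "K \<in> carrier_mat r (p + r)" and N: "N \<in> carrier_mat p (p + r)"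
    and Kh: "Kh \<in> carrier_mat p (p + r)" and Nh: "Nh \<in> carrier_mat r (p + r)"
    and eqs: "K * Nh\<^sup>T = 1\<^sub>m r" "K * N\<^sup>T = 0\<^sub>m r p" "Kh * N\<^sup>T = 1\<^sub>m p"
      "Nh\<^sup>T * K + N\<^sup>T * Kh = 1\<^sub>m (p + r)"
    using assms(2) unfolding complementary_bases_def by auto
  note T = transpose_carrier_mat[THEN iffD2]
  have tr: "map_mat h (A\<^sup>T) = (map_mat h A)\<^sup>T" for A
    by (rule eq_matI) auto
  have add: "map_mat h (A + B) = map_mat h A + map_mat h B"
    if "A \<in> carrier_mat i j" "B \<in> carrier_mat i j" for A B i j
    using that by (intro eq_matI) (auto simp: hom_distribs)
  have zero: "map_mat h (0\<^sub>m r p) = 0\<^sub>m r p"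
    by (rule eq_matI) auto
  show ?thesis
    unfolding complementary_bases_def
    using K N Kh Nh arg_cong[OF eqs(1), of "map_mat h"] arg_cong[OF eqs(2), of "map_mat h"]
      arg_cong[OF eqs(3), of "map_mat h"] arg_cong[OF eqs(4), of "map_mat h"]
    by (simp add: mat_hom_one zero tr add[of _ "p + r" "p + r"]
        mat_hom_mult[OF K T[OF Nh]] mat_hom_mult[OF K T[OF N]] mat_hom_mult[OF Kh T[OF N]]
        mat_hom_mult[OF T[OF Nh] K] mat_hom_mult[OF T[OF N] Kh])
qed

text \<open>
  The identities are read off the four blocks of \<open>U U\<^sup>-\<^sup>1\<close> and the single block of \<open>U\<^sup>-\<^sup>1 U\<close>. The
  size of \<open>N\<close> comes from duality if \<open>K\<close> is present, and from the convention \<open>N = 1\<close> if it is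
  absent, so the absent case is covered with \<open>r = 0\<close>.
\<close>

lemma unimodular_completion_complementary:
  assumes "K \<in> carrier_mat r (p + r)" and "unimodular_completion K N Kh Nh"
  shows "complementary_bases r p K N Kh Nh"
proof -
  have Kh: "Kh \<in> carrier_mat p (p + r)" and Nh: "Nh \<in> carrier_mat r (p + r)"
    and inv1: "inverts_mat (K @\<^sub>r Kh) (Nh\<^sup>T @\<^sub>c N\<^sup>T)"
    and inv2: "inverts_mat (Nh\<^sup>T @\<^sub>c N\<^sup>T) (K @\<^sub>r Kh)"
    using assms unfolding unimodular_completion_def by auto
  have N: "N \<in> carrier_mat p (p + r)"
    using assms unfolding unimodular_completion_def dual_minimal_bases_def
    by (auto split: if_splits)
  note K = assms(1)
  note T = transpose_carrier_mat[THEN iffD2]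
  have rows: "K @\<^sub>r Kh = four_block_mat K (0\<^sub>m r 0) Kh (0\<^sub>m p 0)"
    using K Kh unfolding append_rows_def by auto
  have cols: "Nh\<^sup>T @\<^sub>c N\<^sup>T = four_block_mat (Nh\<^sup>T) (N\<^sup>T) (0\<^sub>m 0 r) (0\<^sub>m 0 p)"
    using N Nh unfolding append_cols_def by auto
  have "four_block_mat (K * Nh\<^sup>T) (K * N\<^sup>T) (Kh * Nh\<^sup>T) (Kh * N\<^sup>T)
      = (K @\<^sub>r Kh) * (Nh\<^sup>T @\<^sub>c N\<^sup>T)"
    unfolding rows cols using K Kh N Nh
    by (subst mult_four_block_mat[of _ r "p + r" _ 0 _ p _ _ r _ p]) auto
  also have "\<dots> = four_block_mat (1\<^sub>m r) (0\<^sub>m r p) (0\<^sub>m p r) (1\<^sub>m p)"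
    using inv1 K Kh unfolding inverts_mat_def by (simp add: append_rows_def)
  finally have eq: "four_block_mat (K * Nh\<^sup>T) (K * N\<^sup>T) (Kh * Nh\<^sup>T) (Kh * N\<^sup>T)
      = four_block_mat (1\<^sub>m r) (0\<^sub>m r p) (0\<^sub>m p r) (1\<^sub>m p)" .
  (* The blocks are compared entrywise: a shift of the row or column index by r selects the block. *)
  have entry: "four_block_mat (K * Nh\<^sup>T) (K * N\<^sup>T) (Kh * Nh\<^sup>T) (Kh * N\<^sup>T) $$ ij
      = four_block_mat (1\<^sub>m r) (0\<^sub>m r p) (0\<^sub>m p r) (1\<^sub>m p) $$ ij" for ij
    unfolding eq ..
  have c1: "K * Nh\<^sup>T = 1\<^sub>m r"
  proof (rule eq_matI)
    fix i j assume "i < dim_row (1\<^sub>m r :: 'a poly mat)" "j < dim_col (1\<^sub>m r :: 'a poly mat)"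
    then show "(K * Nh\<^sup>T) $$ (i, j) = 1\<^sub>m r $$ (i, j)"
      using entry[of "(i, j)"] K Kh N Nh by simp
  qed (use K Nh in auto)
  have c2: "K * N\<^sup>T = 0\<^sub>m r p"
  proof (rule eq_matI)
    fix i j assume "i < dim_row (0\<^sub>m r p :: 'a poly mat)" "j < dim_col (0\<^sub>m r p :: 'a poly mat)"
    then show "(K * N\<^sup>T) $$ (i, j) = 0\<^sub>m r p $$ (i, j)"
      using entry[of "(i, j + r)"] K Kh N Nh by simp
  qed (use K N in auto)
  have c3: "Kh * N\<^sup>T = 1\<^sub>m p"
  proof (rule eq_matI)
    fix i j assume "i < dim_row (1\<^sub>m p :: 'a poly mat)" "j < dim_col (1\<^sub>m p :: 'a poly mat)"
    then show "(Kh * N\<^sup>T) $$ (i, j) = 1\<^sub>m p $$ (i, j)"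
      using entry[of "(i + r, j + r)"] K Kh N Nh by simp
  qed (use Kh N in auto)
  have "(Nh\<^sup>T @\<^sub>c N\<^sup>T) * (K @\<^sub>r Kh)
      = four_block_mat (Nh\<^sup>T * K + N\<^sup>T * Kh) (0\<^sub>m (p + r) 0) (0\<^sub>m 0 (p + r)) (0\<^sub>m 0 0)"
    unfolding rows cols using K Kh N Nh
    by (subst mult_four_block_mat[of _ "p + r" r _ p _ 0 _ _ "p + r" _ 0]) auto
  also have "\<dots> = Nh\<^sup>T * K + N\<^sup>T * Kh"
    using K Kh N Nh by (intro eq_matI) auto
  finally have c4: "Nh\<^sup>T * K + N\<^sup>T * Kh = 1\<^sub>m (p + r)"
    using inv2 N Nh unfolding inverts_mat_def by (simp add: append_cols_def)
  show ?thesis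
    unfolding complementary_bases_def using K N Kh Nh c1 c2 c3 c4 by simp
qed

section \<open>Kernels of the block matrix and of the compressed matrix\<close>

lemma block_mult_append_eq_0_iff:
  assumes "M \<in> carrier_mat a b" "K1 \<in> carrier_mat c b" "K2 \<in> carrier_mat d a"
    and "z1 \<in> carrier_vec b" "z2 \<in> carrier_vec d"
  shows "four_block_mat M K2\<^sup>T K1 (0\<^sub>m c d) *\<^sub>v (z1 @\<^sub>v z2) = 0\<^sub>v (a + c) \<longleftrightarrow>
    M *\<^sub>v z1 + K2\<^sup>T *\<^sub>v z2 = 0\<^sub>v a \<and> K1 *\<^sub>v z1 = 0\<^sub>v c"
proof -
  have zero: "0\<^sub>v (a + c) = 0\<^sub>v a @\<^sub>v 0\<^sub>v c"
    by (intro eq_vecI) auto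
  have "four_block_mat M K2\<^sup>T K1 (0\<^sub>m c d) *\<^sub>v (z1 @\<^sub>v z2)
      = (M *\<^sub>v z1 + K2\<^sup>T *\<^sub>v z2) @\<^sub>v (K1 *\<^sub>v z1)"
    using assms by (subst four_block_mat_mult_vec[of _ a b _ d _ c]) auto
  moreover have "M *\<^sub>v z1 + K2\<^sup>T *\<^sub>v z2 \<in> carrier_vec a"
    using assms by auto
  ultimately show ?thesis
    unfolding zero by (simp add: append_vec_eq[of _ a])
qed

text \<open>
  Since \<open>K1 z1 = 0\<close>, the vector \<open>z1\<close> equals \<open>N1\<^sup>T x\<close> with \<open>x = Kh1 z1\<close>, and \<open>N2\<close> annihilates the
  contribution \<open>K2\<^sup>T z2\<close> to the top rows. Conversely \<open>x\<close> determines \<open>z1\<close>, and then \<open>z2\<close>, because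
  \<open>Nh2 K2\<^sup>T = 1\<close>.
\<close>

lemma block_kernel_imp_Q_kernel:
  assumes c1: "complementary_bases m1 n K1 N1 Kh1 Nh1"
    and c2: "complementary_bases m2 m K2 N2 Kh2 Nh2"
    and M: "M \<in> carrier_mat (m + m2) (n + m1)"
    and z1: "z1 \<in> carrier_vec (n + m1)" and z2: "z2 \<in> carrier_vec m2"
    and ker: "four_block_mat M K2\<^sup>T K1 (0\<^sub>m m1 m2) *\<^sub>v (z1 @\<^sub>v z2) = 0\<^sub>v (m + m2 + m1)"
  shows "(N2 * M * N1\<^sup>T) *\<^sub>v (Kh1 *\<^sub>v z1) = 0\<^sub>v m"
    and "Kh1 *\<^sub>v z1 = 0\<^sub>v n \<Longrightarrow> z1 @\<^sub>v z2 = 0\<^sub>v (n + m1 + m2)"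
proof -
  have K1: "K1 \<in> carrier_mat m1 (n + m1)" and N1: "N1 \<in> carrier_mat n (n + m1)"
    and Kh1: "Kh1 \<in> carrier_mat n (n + m1)" and Nh1: "Nh1 \<in> carrier_mat m1 (n + m1)"
    using c1 unfolding complementary_bases_def by auto
  have K2: "K2 \<in> carrier_mat m2 (m + m2)" and N2: "N2 \<in> carrier_mat m (m + m2)"
    and Nh2: "Nh2 \<in> carrier_mat m2 (m + m2)"
    using c2 unfolding complementary_bases_def by auto
  have top: "M *\<^sub>v z1 + K2\<^sup>T *\<^sub>v z2 = 0\<^sub>v (m + m2)" and bot: "K1 *\<^sub>v z1 = 0\<^sub>v m1"
    using ker block_mult_append_eq_0_iff[OF M K1 K2 z1 z2] by auto
  have x: "Kh1 *\<^sub>v z1 \<in> carrier_vec n" using Kh1 z1 by auto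
  have z1_eq: "z1 = N1\<^sup>T *\<^sub>v (Kh1 *\<^sub>v z1)"
  proof -
    have "Nh1\<^sup>T *\<^sub>v 0\<^sub>v m1 = 0\<^sub>v (n + m1)" using Nh1 by auto
    then show ?thesis
      using complementary_bases_vec(1)[OF c1 z1] N1 x unfolding bot by simp
  qed
  have "N2 *\<^sub>v (M *\<^sub>v z1) = N2 *\<^sub>v (M *\<^sub>v z1) + N2 *\<^sub>v (K2\<^sup>T *\<^sub>v z2)"
    using complementary_bases_vec(5)[OF c2 z2] N2 M z1 by simp
  also have "\<dots> = N2 *\<^sub>v (M *\<^sub>v z1 + K2\<^sup>T *\<^sub>v z2)"
    using mult_add_distrib_mat_vec[OF N2, of "M *\<^sub>v z1" "K2\<^sup>T *\<^sub>v z2"] M K2 z1 z2 by simp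
  also have "\<dots> = 0\<^sub>v m" unfolding top using N2 by auto
  finally have NMz: "N2 *\<^sub>v (M *\<^sub>v z1) = 0\<^sub>v m" .
  have "(N2 * M * N1\<^sup>T) *\<^sub>v (Kh1 *\<^sub>v z1) = (N2 * M) *\<^sub>v (N1\<^sup>T *\<^sub>v (Kh1 *\<^sub>v z1))"
    using N2 M N1 x by (intro assoc_mult_mat_vec[of _ m "n + m1" _ n]) auto
  also have "\<dots> = N2 *\<^sub>v (M *\<^sub>v z1)"
    unfolding z1_eq[symmetric] using N2 M z1 by (intro assoc_mult_mat_vec) auto
  finally show "(N2 * M * N1\<^sup>T) *\<^sub>v (Kh1 *\<^sub>v z1) = 0\<^sub>v m" using NMz by simp
  assume x0: "Kh1 *\<^sub>v z1 = 0\<^sub>v n"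
  have z10: "z1 = 0\<^sub>v (n + m1)" using z1_eq N1 unfolding x0 by auto
  have "M *\<^sub>v 0\<^sub>v (n + m1) = 0\<^sub>v (m + m2)" using M by auto
  then have "K2\<^sup>T *\<^sub>v z2 = 0\<^sub>v (m + m2)"
    using top K2 z2 unfolding z10 by simp
  then have "z2 = 0\<^sub>v m2"
    using complementary_bases_vec(6)[OF c2 z2] Nh2 by auto
  then show "z1 @\<^sub>v z2 = 0\<^sub>v (n + m1 + m2)"
    unfolding z10 by (intro eq_vecI) auto
qed

text \<open>
  The vector \<open>u = M N1\<^sup>T v\<close> is annihilated by \<open>N2\<close>, so \<open>u = K2\<^sup>T (Nh2 u)\<close>; this forces the choice
  \<open>- Nh2 u\<close> of the lower part, which cancels \<open>u\<close> in the top rows.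
\<close>

lemma Q_kernel_imp_block_kernel:
  assumes c1: "complementary_bases m1 n K1 N1 Kh1 Nh1"
    and c2: "complementary_bases m2 m K2 N2 Kh2 Nh2"
    and M: "M \<in> carrier_mat (m + m2) (n + m1)"
    and v: "v \<in> carrier_vec n" and ker: "(N2 * M * N1\<^sup>T) *\<^sub>v v = 0\<^sub>v m"
  shows "four_block_mat M K2\<^sup>T K1 (0\<^sub>m m1 m2) *\<^sub>v
      (N1\<^sup>T *\<^sub>v v @\<^sub>v - (Nh2 *\<^sub>v (M *\<^sub>v (N1\<^sup>T *\<^sub>v v)))) = 0\<^sub>v (m + m2 + m1)"
proof -
  have K1: "K1 \<in> carrier_mat m1 (n + m1)" and N1: "N1 \<in> carrier_mat n (n + m1)"
    using c1 unfolding complementary_bases_def by auto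
  have K2: "K2 \<in> carrier_mat m2 (m + m2)" and N2: "N2 \<in> carrier_mat m (m + m2)"
    and Kh2: "Kh2 \<in> carrier_mat m (m + m2)" and Nh2: "Nh2 \<in> carrier_mat m2 (m + m2)"
    using c2 unfolding complementary_bases_def by auto
  let ?z1 = "N1\<^sup>T *\<^sub>v v"
  let ?u = "M *\<^sub>v ?z1"
  have z1: "?z1 \<in> carrier_vec (n + m1)" and u: "?u \<in> carrier_vec (m + m2)"
    using N1 M v by auto
  have z2: "- (Nh2 *\<^sub>v ?u) \<in> carrier_vec m2"
    using Nh2 u by auto
  have "(N2 * M * N1\<^sup>T) *\<^sub>v v = (N2 * M) *\<^sub>v ?z1"
    using N2 M N1 v by (intro assoc_mult_mat_vec[of _ m "n + m1" _ n]) auto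
  also have "\<dots> = N2 *\<^sub>v ?u"
    using N2 M z1 by (intro assoc_mult_mat_vec) auto
  finally have N2u: "N2 *\<^sub>v ?u = 0\<^sub>v m" using ker by simp
  have "Kh2\<^sup>T *\<^sub>v 0\<^sub>v m = 0\<^sub>v (m + m2)" using Kh2 by auto
  then have u_eq: "K2\<^sup>T *\<^sub>v (Nh2 *\<^sub>v ?u) = ?u"
    using complementary_bases_vec(2)[OF c2 u] K2 Nh2 u unfolding N2u by simp
  have "K2\<^sup>T *\<^sub>v (- (Nh2 *\<^sub>v ?u)) = - (K2\<^sup>T *\<^sub>v (Nh2 *\<^sub>v ?u))"
    using K2 Nh2 u by (intro eq_vecI) (auto simp: scalar_prod_def sum_negf)
  then have "?u + K2\<^sup>T *\<^sub>v (- (Nh2 *\<^sub>v ?u)) = 0\<^sub>v (m + m2)"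
    unfolding u_eq using u by simp
  then show ?thesis
    unfolding block_mult_append_eq_0_iff[OF M K1 K2 z1 z2]
    using complementary_bases_vec(3)[OF c1 v] by simp
qed

text \<open>
  A nonzero kernel vector \<open>v\<close> of \<open>Q\<close> lifts to one of the block matrix; the lift is nonzero because
  \<open>Kh1 (N1\<^sup>T v) = v\<close>. For polynomial entries this transfers regularity from the block matrix to \<open>Q\<close>.
\<close>

lemma det_block_eq_0_if_det_Q_eq_0:
  fixes M :: "'a :: idom mat"
  assumes c1: "complementary_bases m1 n K1 N1 Kh1 Nh1"
    and c2: "complementary_bases m2 n K2 N2 Kh2 Nh2"
    and M: "M \<in> carrier_mat (n + m2) (n + m1)"
    and det: "det (N2 * M * N1\<^sup>T) = 0"
  shows "det (four_block_mat M K2\<^sup>T K1 (0\<^sub>m m1 m2)) = 0"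
proof -
  have N1: "N1 \<in> carrier_mat n (n + m1)"
    using c1 unfolding complementary_bases_def by auto
  have N2: "N2 \<in> carrier_mat n (n + m2)" and Nh2: "Nh2 \<in> carrier_mat m2 (n + m2)"
    using c2 unfolding complementary_bases_def by auto
  have Q: "N2 * M * N1\<^sup>T \<in> carrier_mat n n"
    using N1 N2 M by auto
  obtain v where v: "v \<in> carrier_vec n" "v \<noteq> 0\<^sub>v n" and ker: "(N2 * M * N1\<^sup>T) *\<^sub>v v = 0\<^sub>v n"
    using det det_0_iff_vec_prod_zero[OF Q] by auto
  let ?z1 = "N1\<^sup>T *\<^sub>v v"
  let ?z2 = "- (Nh2 *\<^sub>v (M *\<^sub>v ?z1))"
  have z1: "?z1 \<in> carrier_vec (n + m1)" using N1 v by auto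
  have z2: "?z2 \<in> carrier_vec m2" using Nh2 M z1 by auto
  have L: "four_block_mat M K2\<^sup>T K1 (0\<^sub>m m1 m2) \<in> carrier_mat (n + m2 + m1) (n + m2 + m1)"
    using four_block_carrier_mat[OF M, of "0\<^sub>m m1 m2" m1 m2] by (simp add: ac_simps)
  have z: "?z1 @\<^sub>v ?z2 \<in> carrier_vec (n + m2 + m1)"
    using append_carrier_vec[OF z1 z2] by (simp add: ac_simps)
  have "?z1 @\<^sub>v ?z2 \<noteq> 0\<^sub>v (n + m2 + m1)"
  proof
    assume "?z1 @\<^sub>v ?z2 = 0\<^sub>v (n + m2 + m1)"
    also have "\<dots> = 0\<^sub>v (n + m1) @\<^sub>v 0\<^sub>v m2" by (intro eq_vecI) auto
    finally have "?z1 = 0\<^sub>v (n + m1)"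
      using append_vec_eq[OF z1] by auto
    moreover have "Kh1 *\<^sub>v 0\<^sub>v (n + m1) = 0\<^sub>v n"
      using c1 unfolding complementary_bases_def by auto
    ultimately have "v = 0\<^sub>v n"
      using complementary_bases_vec(4)[OF c1 v(1)] by simp
    with v(2) show False by simp
  qed
  then show ?thesis
    using det_0_iff_vec_prod_zero[OF L] z Q_kernel_imp_block_kernel[OF c1 c2 M v(1) ker] by blast
qed

section \<open>Evaluation at a point of the algebraic closure\<close>

lemma eval_hom: "comm_ring_hom (\<lambda>p :: 'a :: field poly. poly (map_poly to_ac p) x0)"
proof -
  interpret ac: comm_ring_hom "to_ac :: 'a \<Rightarrow> 'a alg_closure"
    by unfold_locales auto
  interpret mp: map_poly_comm_ring_hom "to_ac :: 'a \<Rightarrow> 'a alg_closure" ..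
  show ?thesis
    by unfold_locales (auto simp: hom_distribs)
qed

lemma eval_mat_mult:
  assumes "A \<in> carrier_mat a b" "B \<in> carrier_mat b c"
  shows "eval_mat (A * B) x0 = eval_mat A x0 * eval_mat B x0"
  using semiring_hom.mat_hom_mult[OF _ assms] eval_hom
  unfolding eval_mat_def comm_ring_hom_def ring_hom_def by blast

lemma eval_mat_transpose: "eval_mat (A\<^sup>T) x0 = (eval_mat A x0)\<^sup>T"
  unfolding eval_mat_def by (rule eq_matI) auto

lemma dim_eval_mat [simp]:
  "dim_row (eval_mat A x0) = dim_row A" "dim_col (eval_mat A x0) = dim_col A"
  unfolding eval_mat_def by auto

lemma eval_mat_carrier [simp]: "eval_mat A x0 \<in> carrier_mat a b \<longleftrightarrow> A \<in> carrier_mat a b"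
  unfolding carrier_mat_def by simp

lemma eval_block_minimal_bases_mat:
  "eval_mat (block_minimal_bases_mat M K1 K2) x0 =
     four_block_mat (eval_mat M x0) ((eval_mat K2 x0)\<^sup>T) (eval_mat K1 x0)
       (0\<^sub>m (dim_row K1) (dim_row K2))"
  if "M \<in> carrier_mat (m + m2) (n + m1)" "K1 \<in> carrier_mat m1 (n + m1)"
    "K2 \<in> carrier_mat m2 (m + m2)"
proof -
  note dims = that[THEN carrier_matD(1)] that[THEN carrier_matD(2)]
  show ?thesis
    unfolding eval_mat_def block_minimal_bases_mat_def
    by (intro eq_matI) (simp_all add: dims)
qed

lemma append_cols_zero_mult_vec:
  assumes "A \<in> carrier_mat a b" "u \<in> carrier_vec b" "v \<in> carrier_vec c"
  shows "(A @\<^sub>c 0\<^sub>m a c) *\<^sub>v (u @\<^sub>v v) = A *\<^sub>v u"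
proof -
  have "(A @\<^sub>c 0\<^sub>m a c) *\<^sub>v (u @\<^sub>v v) = (A *\<^sub>v u + 0\<^sub>m a c *\<^sub>v v) @\<^sub>v (0\<^sub>m 0 b *\<^sub>v u + 0\<^sub>m 0 c *\<^sub>v v)"
    unfolding append_cols_def using assms by (subst four_block_mat_mult_vec[of _ a b _ c _ 0]) auto
  also have "\<dots> = A *\<^sub>v u"
    using assms by (intro eq_vecI) auto
  finally show ?thesis .
qed

section \<open>Recovery of eigenvectors\<close>

text \<open>
  The kernel lemma at the point \<open>x0\<close> gives a nonzero \<open>x\<close> with \<open>Q(x0) x = 0\<close>; hence \<open>det Q(x0) = 0\<close>.
  That \<open>x0\<close> is an eigenvalue also requires \<open>det Q\<close> to be a nonzero polynomial, which no
  computation at the single point \<open>x0\<close> can show; it follows from the determinant lemma over the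
  polynomial ring.
\<close>

lemma right_eigenvector_recovery:
  assumes c1: "complementary_bases m1 n K1 N1 Kh1 Nh1"
    and c2: "complementary_bases m2 n K2 N2 Kh2 Nh2"
    and M: "M \<in> carrier_mat (n + m2) (n + m1)"
    and z: "right_eigenvector (block_minimal_bases_mat M K1 K2) x0 z"
  shows "right_eigenvector (N2 * M * N1\<^sup>T) x0 ((eval_mat Kh1 x0 @\<^sub>c 0\<^sub>m n m2) *\<^sub>v z)"
proof -
  let ?L = "block_minimal_bases_mat M K1 K2"
  let ?Q = "N2 * M * N1\<^sup>T"
  have K1: "K1 \<in> carrier_mat m1 (n + m1)" and N1: "N1 \<in> carrier_mat n (n + m1)"
    and Kh1: "Kh1 \<in> carrier_mat n (n + m1)"
    using c1 unfolding complementary_bases_def by auto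
  have K2: "K2 \<in> carrier_mat m2 (n + m2)" and N2: "N2 \<in> carrier_mat n (n + m2)"
    using c2 unfolding complementary_bases_def by auto
  have Q: "?Q \<in> carrier_mat n n" using N1 N2 M by auto
  have dimL: "dim_row ?L = n + m2 + m1" "dim_col ?L = n + m1 + m2"
    using M K1 K2 unfolding block_minimal_bases_mat_def by auto
  define z1 where "z1 = vec_first z (n + m1)"
  define z2 where "z2 = vec_last z m2"
  have z1: "z1 \<in> carrier_vec (n + m1)" and z2: "z2 \<in> carrier_vec m2"
    unfolding z1_def z2_def by auto
  have z_eq: "z = z1 @\<^sub>v z2"
    using z unfolding right_eigenvector_def dimL z1_def z2_def by simp
  have z0: "z \<noteq> 0\<^sub>v (n + m1 + m2)" and kerL: "eval_mat ?L x0 *\<^sub>v z = 0\<^sub>v (n + m2 + m1)"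
    using z unfolding right_eigenvector_def dimL by auto
  define x where "x = eval_mat Kh1 x0 *\<^sub>v z1"
  have x_eq: "(eval_mat Kh1 x0 @\<^sub>c 0\<^sub>m n m2) *\<^sub>v z = x"
    unfolding z_eq x_def using Kh1 z1 z2 by (intro append_cols_zero_mult_vec) auto
  note e1 = complementary_bases_hom[OF eval_hom c1, of x0, folded eval_mat_def]
  note e2 = complementary_bases_hom[OF eval_hom c2, of x0, folded eval_mat_def]
  have eM: "eval_mat M x0 \<in> carrier_mat (n + m2) (n + m1)" using M by simp
  have ker: "four_block_mat (eval_mat M x0) ((eval_mat K2 x0)\<^sup>T) (eval_mat K1 x0) (0\<^sub>m m1 m2)
      *\<^sub>v (z1 @\<^sub>v z2) = 0\<^sub>v (n + m2 + m1)"
    using kerL K1 K2 unfolding eval_block_minimal_bases_mat[OF M K1 K2] z_eq by simp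
  have NM: "N2 * M \<in> carrier_mat n (n + m1)" and N1T: "N1\<^sup>T \<in> carrier_mat (n + m1) n"
    using N1 N2 M by auto
  have evalQ: "eval_mat ?Q x0 = eval_mat N2 x0 * eval_mat M x0 * (eval_mat N1 x0)\<^sup>T"
    unfolding eval_mat_mult[OF NM N1T] eval_mat_mult[OF N2 M] eval_mat_transpose ..
  have Qx: "eval_mat ?Q x0 *\<^sub>v x = 0\<^sub>v n"
    unfolding evalQ x_def by (rule block_kernel_imp_Q_kernel(1)[OF e1 e2 eM z1 z2 ker])
  have x0: "x \<noteq> 0\<^sub>v n"
    using block_kernel_imp_Q_kernel(2)[OF e1 e2 eM z1 z2 ker] z0 unfolding x_def z_eq by blast
  have x: "x \<in> carrier_vec n"
    unfolding x_def using Kh1 z1 by (intro mult_mat_vec_carrier[of _ n "n + m1"]) simp_all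
  have "det ?L \<noteq> 0"
    using z unfolding right_eigenvector_def finite_eigenvalue_def regular_matpoly_def by simp
  then have "det ?Q \<noteq> 0"
    using det_block_eq_0_if_det_Q_eq_0[OF c1 c2 M] K1 K2
    unfolding block_minimal_bases_mat_def by auto
  moreover have "det (eval_mat ?Q x0) = 0"
    using det_0_iff_vec_prod_zero[of "eval_mat ?Q x0" n] Q x x0 Qx by auto
  ultimately have "finite_eigenvalue ?Q x0"
    using carrier_matD[OF Q] unfolding finite_eigenvalue_def regular_matpoly_def square_mat.simps
    by presburger
  then show ?thesis
    unfolding right_eigenvector_def x_eq carrier_matD[OF Q] using x x0 Qx by blast
qed

lemma row_vec_mult_mat_transpose: "y \<in> carrier_vec (dim_row A) \<Longrightarrow> y \<^sub>v* A = A\<^sup>T *\<^sub>v y"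
  for y :: "'a :: comm_semiring_0 vec"
  unfolding row_vec_mult_mat_def
  by (intro eq_vecI) (auto intro!: comm_scalar_prod[of _ "dim_row A"])

text \<open>
  If \<open>P\<close> is not square, both sides are false because a finite eigenvalue presupposes regularity.
\<close>

lemma left_eigenvector_iff_transpose:
  "left_eigenvector P x0 y \<longleftrightarrow> right_eigenvector (P\<^sup>T) x0 y"
proof (cases "dim_col P = dim_row P")
  case True
  define k where "k = dim_row P"
  have P: "P \<in> carrier_mat k k" and dims: "dim_row P = k" "dim_col P = k"
    using True unfolding k_def by auto
  have detT: "det (P\<^sup>T) = det P" "det ((eval_mat P x0)\<^sup>T) = det (eval_mat P x0)"
    using det_transpose[OF P] det_transpose[of "eval_mat P x0" k] P by auto
  have "finite_eigenvalue (P\<^sup>T) x0 \<longleftrightarrow> finite_eigenvalue P x0"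
    unfolding finite_eigenvalue_def regular_matpoly_def eval_mat_transpose detT
    by (simp add: dims)
  moreover have "y \<^sub>v* eval_mat P x0 = (eval_mat P x0)\<^sup>T *\<^sub>v y" if "y \<in> carrier_vec k"
    using that by (intro row_vec_mult_mat_transpose) (simp add: dims)
  ultimately show ?thesis
    unfolding left_eigenvector_def right_eigenvector_def eval_mat_transpose
    by (auto simp: dims)
next
  case False
  then show ?thesis
    unfolding left_eigenvector_def right_eigenvector_def finite_eigenvalue_def regular_matpoly_def
    by auto
qed

lemma block_minimal_bases_mat_transpose:
  assumes "M \<in> carrier_mat (m + m2) (n + m1)" "K1 \<in> carrier_mat m1 (n + m1)"
    "K2 \<in> carrier_mat m2 (m + m2)"
  shows "(block_minimal_bases_mat M K1 K2)\<^sup>T = block_minimal_bases_mat (M\<^sup>T) K2 K1"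
proof -
  have dims: "dim_row K1 = m1" "dim_row K2 = m2" and K2T: "K2\<^sup>T \<in> carrier_mat (m + m2) m2"
    using assms(2,3) by simp_all
  show ?thesis
    unfolding block_minimal_bases_mat_def dims
      transpose_four_block_mat[OF assms(1) K2T assms(2) zero_carrier_mat]
    by simp
qed

theorem theorem6p8:
  fixes l m n m1 m2 :: nat
    and M K1 K2 N1 N2 Kh1 Kh2 Nh1 Nh2 L Q :: "'a :: field poly mat"
    and lam0 :: "'a alg_closure"
    and z w :: "'a alg_closure vec"
  assumes "strong_block_minimal_bases l m n m1 m2 M K1 K2"
    and "L = block_minimal_bases_mat M K1 K2"
    and "square_mat L"
    and "regular_matpoly L"
    and "unimodular_completion K1 N1 Kh1 Nh1"
    and "unimodular_completion K2 N2 Kh2 Nh2"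
    and "Q = N2 * M * N1\<^sup>T"
    and "finite_eigenvalue L lam0"
    and "right_eigenvector L lam0 z"
    and "left_eigenvector L lam0 w"
  shows "right_eigenvector Q lam0 ((eval_mat Kh1 lam0 @\<^sub>c 0\<^sub>m n m2) *\<^sub>v z) \<and>
         left_eigenvector Q lam0 (w \<^sub>v* ((eval_mat Kh2 lam0)\<^sup>T @\<^sub>r 0\<^sub>m m1 m))"
proof -
  have M': "M \<in> carrier_mat (m + m2) (n + m1)"
    and K1: "K1 \<in> carrier_mat m1 (n + m1)" and K2': "K2 \<in> carrier_mat m2 (m + m2)"
    using assms(1) unfolding strong_block_minimal_bases_def by auto
  have dimL: "dim_row L = m + m2 + m1" "dim_col L = n + m1 + m2"
    using M' K1 K2' unfolding assms(2) block_minimal_bases_mat_def by auto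
  (* The two dimensions of L are m + m2 + m1 and n + m1 + m2, so squareness of L is m = n. *)
  then have mn: "m = n" using assms(3) by simp
  note M = M'[unfolded mn] and K2 = K2'[unfolded mn]
  have c1: "complementary_bases m1 n K1 N1 Kh1 Nh1"
    by (rule unimodular_completion_complementary[OF K1 assms(5)])
  have c2: "complementary_bases m2 n K2 N2 Kh2 Nh2"
    by (rule unimodular_completion_complementary[OF K2 assms(6)])
  have N1: "N1 \<in> carrier_mat n (n + m1)"
    using c1 unfolding complementary_bases_def by auto
  have N2: "N2 \<in> carrier_mat n (n + m2)" and Kh2: "Kh2 \<in> carrier_mat n (n + m2)"
    using c2 unfolding complementary_bases_def by auto
  have right: "right_eigenvector Q lam0 ((eval_mat Kh1 lam0 @\<^sub>c 0\<^sub>m n m2) *\<^sub>v z)"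
    unfolding assms(7) using right_eigenvector_recovery[OF c1 c2 M] assms(2,9) by simp

  have NM: "N2 * M \<in> carrier_mat n (n + m1)" and N1T: "N1\<^sup>T \<in> carrier_mat (n + m1) n"
    and MT: "M\<^sup>T \<in> carrier_mat (n + m1) (n + m2)" and N2T: "N2\<^sup>T \<in> carrier_mat (n + m2) n"
    using N1 N2 M by auto
  have QT: "Q\<^sup>T = N1 * M\<^sup>T * N2\<^sup>T"
    unfolding assms(7) transpose_mult[OF NM N1T] transpose_mult[OF N2 M] transpose_transpose
    by (rule assoc_mult_mat[OF N1 MT N2T, symmetric])
  have "right_eigenvector (block_minimal_bases_mat (M\<^sup>T) K2 K1) lam0 w"
    using assms(10) unfolding left_eigenvector_iff_transpose assms(2)
      block_minimal_bases_mat_transpose[OF M K1 K2] .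
  then have left: "right_eigenvector (Q\<^sup>T) lam0 ((eval_mat Kh2 lam0 @\<^sub>c 0\<^sub>m n m1) *\<^sub>v w)"
    unfolding QT using M by (intro right_eigenvector_recovery[OF c2 c1]) auto
  have "w \<in> carrier_vec (dim_row L)"
    using assms(10) unfolding left_eigenvector_def by simp
  then have "w \<^sub>v* ((eval_mat Kh2 lam0)\<^sup>T @\<^sub>r 0\<^sub>m m1 m)
      = ((eval_mat Kh2 lam0)\<^sup>T @\<^sub>r 0\<^sub>m m1 m)\<^sup>T *\<^sub>v w"
    using Kh2 by (intro row_vec_mult_mat_transpose) (simp add: dimL mn append_rows_def)
  also have "((eval_mat Kh2 lam0)\<^sup>T @\<^sub>r 0\<^sub>m m1 m)\<^sup>T = eval_mat Kh2 lam0 @\<^sub>c 0\<^sub>m n m1"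
    using Kh2 unfolding append_rows_def append_cols_def mn by (intro eq_matI) auto
  finally show ?thesis
    using right left by (simp add: left_eigenvector_iff_transpose)
qed

end
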